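(* Let $Y$ be a finite-dimensional real Hilbert space and let $\alpha>0$. The function $$h\colon Y\times Y\to\mathbb{R}\colon (x,y)\mapsto \alpha\|x-y\|$$ is $\alpha\sqrt{2}$-Lipschitz, and a selection of $\partial h$ is given by $$(x,y)\mapsto \alpha\big(\operatorname{sign}(x-y),-\operatorname{sign}(x-y)\big)=\begin{cases}\big(\alpha(x-y)/\|x-y\|,\ \alpha(y-x)/\|y-x\|\big), & \text{if } x\neq y;\\ (0,0), & \text{if } x=y,\end{cases}$$ that is, for every $(x,y)\in Y\times Y$, $$\alpha\big(\operatorname{sign}(x-y),-\operatorname{sign}(x-y)\big)\in\{\alpha(s,-s) : s\in\operatorname{Sign}(x-y)\}=\partial h(x,y).$$ The prox operator of $h$ is given by $$\operatorname{Prox}_h\colon (x,y)\mapsto (x,y)-\frac{1}{\max\{2,\|x-y\|/\alpha\}}\,(x-y,\,y-x).$$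
   Context: $Y$ is a finite-dimensional real Hilbert space with inner product $\langle\cdot,\cdot\rangle$ and induced norm $\|\cdot\|$. The space $Y\times Y$ carries the product Hilbert space structure, $\langle (u,v),(x,y)\rangle=\langle u,x\rangle+\langle v,y\rangle$, so $\|(x,y)\|^2=\|x\|^2+\|y\|^2$. Let $\mathbb{B}=\{y\in Y : \|y\|\le 1\}$. For $x\in Y$, $\operatorname{sign}(x)=x/\|x\|$ if $x\ne 0$ and $\operatorname{sign}(0)=0$; and $\operatorname{Sign}(x)=\{x/\|x\|\}$ if $x\neq 0$ and $\operatorname{Sign}(0)=\mathbb{B}$. For a convex, lower semicontinuous, proper function $f$ on a Hilbert space, the subdifferential $\partial f(z)$ is the set of all vectors $w$ such that $f(z)+\langle w,k\rangle\le f(z+k)$ for every vector $k$, and $\operatorname{Prox}_f(z)$ denotes the unique minimizer of $w\mapsto f(w)+\tfrac12\|z-w\|^2$. A selection of $\partial f$ is a mapping assigning to each $z$ an element of $\partial f(z)$. *)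

theory Defs
  imports "HOL-Analysis.Analysis"
begin

text \<open>
  The single-valued sign \<open>x / \<parallel>x\<parallel>\<close> (with value 0 at 0) is the library's \<^const>\<open>sgn\<close> on
  real normed vector spaces; see \<open>sgn_div_norm\<close>.  The product space carries the library's
  Hilbert structure, \<open>inner_prod_def\<close> and \<open>norm_prod_def\<close>.
\<close>

definition Sign :: "'a::real_normed_vector \<Rightarrow> 'a set" where
  "Sign x = (if x = 0 then cball 0 1 else {x /\<^sub>R norm x})"

text \<open>Only finite-valued functions occur here, and these are automatically proper.\<close>

definition subdifferential :: "('a::real_inner \<Rightarrow> real) \<Rightarrow> 'a \<Rightarrow> 'a set" where
  "subdifferential f z = {w. \<forall>k. f z + inner w k \<le> f (z + k)}"

definition is_selection :: "('a \<Rightarrow> 'b) \<Rightarrow> ('a \<Rightarrow> 'b set) \<Rightarrow> bool" where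
  "is_selection s F \<longleftrightarrow> (\<forall>z. s z \<in> F z)"

definition is_prox_point :: "('a::real_inner \<Rightarrow> real) \<Rightarrow> 'a \<Rightarrow> 'a \<Rightarrow> bool" where
  "is_prox_point f z w \<longleftrightarrow>
     is_arg_min (\<lambda>u. f u + (1 / 2) * (norm (z - u))\<^sup>2) (\<lambda>_. True) w"

text \<open>
  This is meaningful only where the minimizer exists and is unique, so a statement about
  \<open>Prox f z\<close> should be accompanied by \<open>\<exists>!w. is_prox_point f z w\<close>.
\<close>

definition Prox :: "('a::real_inner \<Rightarrow> real) \<Rightarrow> 'a \<Rightarrow> 'a" where
  "Prox f z = (THE w. is_prox_point f z w)"

end

theory Submission
  imports Defs
begin

text \<open>
  The function \<open>h\<close> is \<open>\<alpha>\<close> times the norm, precomposed with the difference map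
  \<open>D (x, y) = x - y\<close>.  The adjoint of \<open>D\<close> is \<open>s \<mapsto> (s, - s)\<close> and \<open>D\<close> has norm at most \<open>sqrt 2\<close>; this gives
  the Lipschitz constant, and it suggests the chain rule \<open>\<partial>(g \<circ> D) = D\<^sup>* \<circ> \<partial>g \<circ> D\<close>, which for
  this particular \<open>D\<close> has a direct proof without any convexity
  (\<open>subdifferential_of_difference\<close>).  Together with \<open>\<partial>\<parallel>\<cdot>\<parallel> = Sign\<close>
  (\<open>subdifferential_norm_eq_Sign\<close>) it gives the formula for \<open>\<partial>h\<close>.

  For the prox operator, a point \<open>w\<close> with \<open>z - w \<in> \<partial>f(w)\<close> is the unique minimizer of the prox
  objective at \<open>z\<close>, because the subgradient inequality makes the objective grow at least like
  \<open>\<parallel>u - w\<parallel>\<^sup>2 / 2\<close> away from \<open>w\<close> (\<open>prox_point_iff_if_subgradient\<close>).  So the candidate only has to be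
  tested against the formula for \<open>\<partial>h\<close>.  Moving from \<open>(x, y)\<close> by \<open>- t (d, - d)\<close> with \<open>d = x - y\<close>
  changes the difference to \<open>(1 - 2 t) d\<close>.  For \<open>\<parallel>d\<parallel> \<le> 2 \<alpha>\<close> the two components meet at their
  midpoint (\<open>t = 1/2\<close>), where \<open>Sign\<close> is the whole unit ball; otherwise each moves by the full
  length \<open>\<alpha>\<close> (\<open>t = \<alpha> / \<parallel>d\<parallel>\<close>), and the direction of the difference is preserved.
\<close>

section \<open>Subgradients of the norm\<close>

text \<open>
  The norm is the support function of the unit ball, so its subgradients at \<open>z\<close> are the points of
  the ball that attain the supremum of \<open>\<langle>\<cdot>, z\<rangle>\<close>.
\<close>

lemma subdifferential_norm_iff:
  fixes w z :: "'a::real_inner"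
  shows "w \<in> subdifferential norm z \<longleftrightarrow> norm w \<le> 1 \<and> inner w z = norm z"
proof
  assume "w \<in> subdifferential norm z"
  then have sub: "norm z + inner w k \<le> norm (z + k)" for k
    by (simp add: subdifferential_def)
  \<comment> \<open>Along the ray through \<open>z\<close> the norm is linear, so testing outwards and inwards gives
    equality.\<close>
  have "norm (z + z) = 2 * norm z"
    by (simp flip: scaleR_2)
  with sub[of z] sub[of "- z"] have wz: "inner w z = norm z"
    by simp
  \<comment> \<open>The increment \<open>w - z\<close> makes the right-hand side \<open>\<parallel>w\<parallel>\<close>, while by the equality above the left
    is \<open>\<langle>w, w\<rangle>\<close>.\<close>
  have "norm w * norm w \<le> 1 * norm w"
    using sub[of "w - z"] wz by (simp add: inner_diff_right norm_eq_sqrt_inner)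
  then have "norm w \<le> 1"
    by (metis mult_right_le_imp_le norm_ge_zero order_le_less zero_le_one)
  with wz show "norm w \<le> 1 \<and> inner w z = norm z"
    by simp
next
  assume w: "norm w \<le> 1 \<and> inner w z = norm z"
  have "norm z + inner w k \<le> norm (z + k)" for k
  proof -
    have "norm z + inner w k = inner w (z + k)"
      using w by (simp add: inner_add_right)
    also have "\<dots> \<le> norm w * norm (z + k)"
      by (rule norm_cauchy_schwarz)
    also have "\<dots> \<le> norm (z + k)"
      using w by (simp add: mult_left_le_one_le)
    finally show ?thesis .
  qed
  then show "w \<in> subdifferential norm z"
    by (simp add: subdifferential_def)
qed

text \<open>
  At \<open>z \<noteq> 0\<close> the condition \<open>\<langle>w, z\<rangle> = \<parallel>z\<parallel>\<close> with \<open>\<parallel>w\<parallel> \<le> 1\<close> is the equality case of Cauchy-Schwarz,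
  which leaves only the unit vector in the direction of \<open>z\<close>.
\<close>

lemma subdifferential_norm_eq_Sign: "subdifferential norm z = Sign (z :: 'a::real_inner)"
proof (cases "z = 0")
  case True
  then show ?thesis
    by (auto simp: Sign_def subdifferential_norm_iff)
next
  case False
  have "norm w \<le> 1 \<and> inner w z = norm z \<longleftrightarrow> w = z /\<^sub>R norm z" for w
  proof
    assume w: "norm w \<le> 1 \<and> inner w z = norm z"
    have "(norm (w - z /\<^sub>R norm z))\<^sup>2
        = (norm w)\<^sup>2 - 2 * inner w (z /\<^sub>R norm z) + (norm (z /\<^sub>R norm z))\<^sup>2"
      unfolding power2_norm_eq_inner by (simp only: inner_diff_left inner_diff_right inner_commute)
    also have "\<dots> = (norm w)\<^sup>2 - 1"
      using w False by simp
    also have "\<dots> \<le> 0"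
      using w by (simp add: power_le_one)
    finally show "w = z /\<^sub>R norm z"
      by simp
  next
    assume "w = z /\<^sub>R norm z"
    with False show "norm w \<le> 1 \<and> inner w z = norm z"
      by (simp add: dot_square_norm power2_eq_square)
  qed
  then have "subdifferential norm z = {z /\<^sub>R norm z}"
    unfolding set_eq_iff subdifferential_norm_iff singleton_iff by blast
  with False show ?thesis
    by (simp only: Sign_def if_False)
qed

lemma sgn_in_Sign: "sgn z \<in> Sign z"
  by (auto simp: Sign_def sgn_div_norm)

section \<open>Subgradients of the scaled distance\<close>

lemma subdifferential_scale:
  assumes "c > 0"
  shows "subdifferential (\<lambda>z. c * f z) z = (*\<^sub>R) c ` subdifferential f z"
proof (intro set_eqI)
  fix w
  have "w \<in> subdifferential (\<lambda>z. c * f z) z \<longleftrightarrow> w /\<^sub>R c \<in> subdifferential f z"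
    using assms by (simp add: subdifferential_def field_simps)
  also have "\<dots> \<longleftrightarrow> w \<in> (*\<^sub>R) c ` subdifferential f z"
    using assms by (force simp: image_iff)
  finally show "w \<in> subdifferential (\<lambda>z. c * f z) z \<longleftrightarrow> w \<in> (*\<^sub>R) c ` subdifferential f z" .
qed

text \<open>
  A function of \<open>x - y\<close> is constant along the diagonal, so a subgradient vanishes on all pairs
  \<open>(u, u)\<close>; that is, it has the form \<open>(s, - s)\<close>.  Perturbing the first component alone then
  recovers the subgradient inequality of \<open>g\<close> for \<open>s\<close>.
\<close>

lemma subdifferential_of_difference:
  fixes g :: "'a::real_inner \<Rightarrow> real"
  shows "subdifferential (\<lambda>(x, y). g (x - y)) (x, y) = (\<lambda>s. (s, - s)) ` subdifferential g (x - y)"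
proof (intro set_eqI iffI)
  fix w
  assume w: "w \<in> subdifferential (\<lambda>(x, y). g (x - y)) (x, y)"
  obtain a b where ab: "w = (a, b)"
    by (cases w)
  have sub: "g (x - y) + (inner a u + inner b v) \<le> g (x + u - (y + v))" for u v
    using w[unfolded subdifferential_def ab, simplified, rule_format, of u v] .
  have "inner (a + b) (a + b) \<le> 0"
    using sub[of "a + b" "a + b"] by (simp add: inner_add_left)
  then have "a + b = 0"
    by (metis inner_eq_zero_iff inner_ge_zero order_antisym)
  then have "b = - a"
    by (simp add: eq_neg_iff_add_eq_0 add.commute)
  moreover have "a \<in> subdifferential g (x - y)"
    using sub[of _ 0] by (simp add: subdifferential_def algebra_simps)
  ultimately show "w \<in> (\<lambda>s. (s, - s)) ` subdifferential g (x - y)"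
    using ab by blast
next
  fix w
  assume "w \<in> (\<lambda>s. (s, - s)) ` subdifferential g (x - y)"
  then obtain s where w: "w = (s, - s)" and sub: "\<And>k. g (x - y) + inner s k \<le> g (x - y + k)"
    by (auto simp: subdifferential_def)
  have "g (x - y) + (inner s u - inner s v) \<le> g (x + u - (y + v))" for u v
    using sub[of "u - v"] by (simp only: inner_diff_right add_diff_add)
  then show "w \<in> subdifferential (\<lambda>(x, y). g (x - y)) (x, y)"
    by (simp add: w subdifferential_def)
qed

lemma subdifferential_scaled_distance:
  fixes x y :: "'a::real_inner"
  assumes "\<alpha> > 0"
  shows "subdifferential (\<lambda>(x, y). \<alpha> * norm (x - y)) (x, y) = {\<alpha> *\<^sub>R (s, - s) | s. s \<in> Sign (x - y)}"
  unfolding subdifferential_of_difference[of "\<lambda>z. \<alpha> * norm z"]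
    subdifferential_scale[OF assms] subdifferential_norm_eq_Sign
  by (simp add: image_image Setcompr_eq_image)

section \<open>The prox operator\<close>

text \<open>
  Fermat's rule for the prox objective.  Its quadratic term expands exactly around \<open>w\<close>, the linear
  part is absorbed by the subgradient inequality, and the remaining square gives uniqueness.
\<close>

lemma prox_point_iff_if_subgradient:
  assumes "z - w \<in> subdifferential f w"
  shows "is_prox_point f z u \<longleftrightarrow> u = w"
proof -
  have growth: "f w + 1/2 * (norm (z - w))\<^sup>2 + 1/2 * (norm (v - w))\<^sup>2
      \<le> f v + 1/2 * (norm (z - v))\<^sup>2" for v
  proof -
    have "f w + inner (z - w) (v - w) \<le> f (w + (v - w))"
      using assms unfolding subdifferential_def by blast
    moreover have "(norm (z - v))\<^sup>2 = (norm (z - w))\<^sup>2 - 2 * inner (z - w) (v - w) + (norm (v - w))\<^sup>2"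
      by (simp add: power2_norm_eq_inner inner_diff_left inner_diff_right inner_commute)
    ultimately show ?thesis
      by (simp add: diff_divide_distrib add_divide_distrib)
  qed
  show ?thesis
  proof
    assume "is_prox_point f z u"
    then have "f u + 1/2 * (norm (z - u))\<^sup>2 \<le> f w + 1/2 * (norm (z - w))\<^sup>2"
      by (auto simp: is_prox_point_def is_arg_min_def not_less)
    with growth[of u] have "(norm (u - w))\<^sup>2 \<le> 0"
      by linarith
    then show "u = w"
      by simp
  next
    assume "u = w"
    moreover have "f w + 1/2 * (norm (z - w))\<^sup>2 \<le> f v + 1/2 * (norm (z - v))\<^sup>2" for v
      using growth[of v] zero_le_power2[of "norm (v - w)"] by linarith
    ultimately show "is_prox_point f z u"
      by (simp add: is_prox_point_def is_arg_min_def not_less)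
  qed
qed

lemma subgradient_at_prox_of_scaled_distance:
  fixes x y :: "'a::real_inner"
  assumes "\<alpha> > 0"
  defines "v \<equiv> (1 / max 2 (norm (x - y) / \<alpha>)) *\<^sub>R (x - y, y - x)"
  shows "v \<in> subdifferential (\<lambda>(x, y). \<alpha> * norm (x - y)) ((x, y) - v)"
proof -
  define d where "d = x - y"
  define t where "t = 1 / max 2 (norm d / \<alpha>)"
  have v: "v = (t *\<^sub>R d, - (t *\<^sub>R d))"
    by (simp add: v_def t_def d_def flip: scaleR_minus_right)
  have diff: "x - t *\<^sub>R d - (y + t *\<^sub>R d) = (1 - 2 * t) *\<^sub>R d"
    by (simp add: d_def algebra_simps flip: scaleR_2)
  have "(t / \<alpha>) *\<^sub>R d \<in> Sign ((1 - 2 * t) *\<^sub>R d)"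
  proof (cases "norm d \<le> 2 * \<alpha>")
    case True
    then have "norm d / \<alpha> \<le> 2"
      using assms(1) by (simp add: divide_le_eq)
    then have t: "t = 1 / 2"
      by (simp add: t_def max_absorb1)
    show ?thesis
      using True assms(1) unfolding t by (simp add: Sign_def divide_le_eq)
  next
    case False
    then have t: "t = \<alpha> / norm d" and "d \<noteq> 0"
      using assms(1) by (auto simp: t_def field_simps max_def)
    have "1 - 2 * t > 0"
      using False \<open>d \<noteq> 0\<close> unfolding t by (simp add: divide_less_eq)
    moreover have "t / \<alpha> = inverse (norm d)"
      using assms(1) unfolding t by (simp add: divide_inverse)
    ultimately show ?thesis
      using \<open>d \<noteq> 0\<close> by (simp add: Sign_def)
  qed
  moreover have "v = \<alpha> *\<^sub>R ((t / \<alpha>) *\<^sub>R d, - ((t / \<alpha>) *\<^sub>R d))"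
    using assms(1) by (simp add: v)
  ultimately have "v \<in> {\<alpha> *\<^sub>R (s, - s) | s. s \<in> Sign (x - t *\<^sub>R d - (y + t *\<^sub>R d))}"
    unfolding diff by blast
  then show ?thesis
    using subdifferential_scaled_distance[OF assms(1), of "x - t *\<^sub>R d" "y + t *\<^sub>R d"]
    by (simp add: v)
qed

section \<open>The Lipschitz constant and the proposition\<close>

text \<open>
  The constant \<open>sqrt 2\<close> comes from the parallelogram law, which bounds \<open>\<parallel>a - b\<parallel>\<^sup>2\<close> by
  \<open>2 (\<parallel>a\<parallel>\<^sup>2 + \<parallel>b\<parallel>\<^sup>2)\<close>.
\<close>

lemma norm_difference_le_norm_Pair:
  fixes a b :: "'a::real_inner"
  shows "norm (a - b) \<le> sqrt 2 * norm (a, b)"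
proof (rule power2_le_imp_le)
  have "(norm (a - b))\<^sup>2 + (norm (a + b))\<^sup>2 = 2 * ((norm a)\<^sup>2 + (norm b)\<^sup>2)"
    unfolding power2_norm_eq_inner
    by (simp add: inner_diff_left inner_diff_right inner_add_left inner_add_right)
  then have "(norm (a - b))\<^sup>2 \<le> 2 * ((norm a)\<^sup>2 + (norm b)\<^sup>2)"
    using zero_le_power2[of "norm (a + b)"] by linarith
  then show "(norm (a - b))\<^sup>2 \<le> (sqrt 2 * norm (a, b))\<^sup>2"
    unfolding power_mult_distrib norm_Pair by simp
qed simp

lemma lipschitz_on_scaled_distance:
  assumes "\<alpha> \<ge> 0"
  shows "(\<alpha> * sqrt 2)-lipschitz_on UNIV (\<lambda>(x, y :: 'a::real_inner). \<alpha> * norm (x - y))"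
proof (rule lipschitz_onI)
  fix p q :: "'a \<times> 'a"
  obtain x y u v where pq: "p = (x, y)" "q = (u, v)"
    by (cases p, cases q)
  have "\<bar>norm (x - y) - norm (u - v)\<bar> \<le> norm ((x - y) - (u - v))"
    by (rule norm_triangle_ineq3)
  also have "\<dots> = norm ((x - u) - (y - v))"
    by (simp add: algebra_simps)
  also have "\<dots> \<le> sqrt 2 * norm (x - u, y - v)"
    by (rule norm_difference_le_norm_Pair)
  finally have "\<alpha> * \<bar>norm (x - y) - norm (u - v)\<bar> \<le> \<alpha> * (sqrt 2 * norm (x - u, y - v))"
    using assms by (rule mult_left_mono)
  then show "dist (case p of (x, y) \<Rightarrow> \<alpha> * norm (x - y)) (case q of (x, y) \<Rightarrow> \<alpha> * norm (x - y))
      \<le> \<alpha> * sqrt 2 * dist p q"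
    using assms by (simp add: pq dist_norm abs_mult mult.assoc flip: right_diff_distrib)
qed (use assms in simp)

theorem proposition4p2:
  fixes \<alpha> :: real and h :: "'y::real_inner \<times> 'y \<Rightarrow> real"
  assumes finite_dim: "\<exists>B :: 'y set. finite B \<and> span B = UNIV"
    and alpha_pos: "\<alpha> > 0"
    and h: "h = (\<lambda>(x, y). \<alpha> * norm (x - y))"
  shows "(\<alpha> * sqrt 2)-lipschitz_on UNIV h
    \<and> is_selection (\<lambda>(x, y). \<alpha> *\<^sub>R (sgn (x - y), - sgn (x - y))) (subdifferential h)
    \<and> (\<forall>x y :: 'y.
          \<alpha> *\<^sub>R (sgn (x - y), - sgn (x - y)) =
            (if x \<noteq> y
             then ((\<alpha> *\<^sub>R (x - y)) /\<^sub>R norm (x - y), (\<alpha> *\<^sub>R (y - x)) /\<^sub>R norm (y - x))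
             else (0, 0)))
    \<and> (\<forall>x y :: 'y.
          \<alpha> *\<^sub>R (sgn (x - y), - sgn (x - y)) \<in> {\<alpha> *\<^sub>R (s, - s) | s. s \<in> Sign (x - y)}
          \<and> {\<alpha> *\<^sub>R (s, - s) | s. s \<in> Sign (x - y)} = subdifferential h (x, y))
    \<and> (\<forall>x y :: 'y.
          (\<exists>!w. is_prox_point h (x, y) w)
          \<and> Prox h (x, y) =
              (x, y) - (1 / max 2 (norm (x - y) / \<alpha>)) *\<^sub>R (x - y, y - x))"
proof -
  have sub: "subdifferential h (x, y) = {\<alpha> *\<^sub>R (s, - s) | s. s \<in> Sign (x - y)}" for x y
    using subdifferential_scaled_distance[OF alpha_pos] by (simp add: h)
  have sel: "\<alpha> *\<^sub>R (sgn (x - y), - sgn (x - y)) \<in> {\<alpha> *\<^sub>R (s, - s) | s. s \<in> Sign (x - y)}"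
    for x y :: 'y
    using sgn_in_Sign by blast
  have sgn_eq: "\<alpha> *\<^sub>R (sgn (x - y), - sgn (x - y)) =
      (if x \<noteq> y
       then ((\<alpha> *\<^sub>R (x - y)) /\<^sub>R norm (x - y), (\<alpha> *\<^sub>R (y - x)) /\<^sub>R norm (y - x))
       else (0, 0))" for x y :: 'y
    by (simp add: sgn_div_norm norm_minus_commute[of y x] mult.commute flip: scaleR_minus_right)
  have prox: "is_prox_point h (x, y) w \<longleftrightarrow>
      w = (x, y) - (1 / max 2 (norm (x - y) / \<alpha>)) *\<^sub>R (x - y, y - x)" for x y w
    using subgradient_at_prox_of_scaled_distance[OF alpha_pos, of x y]
    by (intro prox_point_iff_if_subgradient) (simp only: h diff_diff_eq2 add_diff_cancel_left')
  have ex1: "\<exists>!w. is_prox_point h (x, y) w" for x y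
    by (simp add: prox)
  have Prox_eq: "Prox h (x, y) = (x, y) - (1 / max 2 (norm (x - y) / \<alpha>)) *\<^sub>R (x - y, y - x)" for x y
    by (simp add: Prox_def prox)
  have lip: "(\<alpha> * sqrt 2)-lipschitz_on UNIV h"
    using lipschitz_on_scaled_distance[of \<alpha>] alpha_pos by (simp add: h)
  have "is_selection (\<lambda>(x, y). \<alpha> *\<^sub>R (sgn (x - y), - sgn (x - y))) (subdifferential h)"
    unfolding is_selection_def split_paired_All case_prod_conv sub using sel by blast
  then show ?thesis
    by (intro conjI allI lip sgn_eq sel sub[symmetric] ex1 Prox_eq)
qed

end
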